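(* Let $E$ be a set, $\mathcal H\subseteq 2^E$ a semi-ring, and $m:\mathcal H\to[0,\infty)$ a $\sigma$-finite and $\sigma$-additive set function. For $A\subseteq E$ let $$\mu(A):=\inf\Big\{\sum_{G\in\mathcal G}m(G):\ \mathcal G\subseteq\mathcal H\text{ countable},\ A\subseteq\bigcup_{G\in\mathcal G}G\Big\},$$ and let $\mathcal F$ be the set of $\mu$-measurable sets, i.e. of all $A\subseteq E$ such that $\mu(B)=\mu(B\cap A)+\mu(B\cap A^c)$ for all $B\subseteq E$. Then $\sigma(\mathcal H)\subseteq\mathcal F$ and $\mu$ coincides with $m$ on $\mathcal H$.
   Context: A semi-ring on $E$ is a collection $\mathcal H\subseteq2^E$ closed under finite (binary) intersections and such that for all $A,B\in\mathcal H$ there is a finite collection $\mathcal K\subseteq\mathcal H$ of pairwise disjoint sets with $B\setminus A=\bigcup_{K\in\mathcal K}K$. The function $m$ is $\sigma$-additive if $m(\bigcup_{K\in\mathcal K}K)=\sum_{K\in\mathcal K}m(K)$ for every countable (possibly finite or empty) collection $\mathcal K\subseteq\mathcal H$ of pairwise disjoint sets with $\bigcup_{K\in\mathcal K}K\in\mathcal H$ (in particular $m(\emptyset)=0$ if $\emptyset\in\mathcal H$). It is $\sigma$-finite if $E$ is covered by countably many sets of $\mathcal H$ on which $m$ is finite. The infimum of the empty set is $+\infty$. $\sigma(\mathcal H)$ is the $\sigma$-algebra on $E$ generated by $\mathcal H$. *)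

theory Defs
  imports "HOL-Analysis.Analysis"
begin

text \<open>The library locale \<open>semiring_of_sets\<close> additionally demands that the empty set belongs to the
  family. Here it need not: \<open>{A}\<close> with \<open>A\<close> nonempty, and the empty family, are semi-rings too.\<close>

definition semi_ring_on :: "'a set \<Rightarrow> 'a set set \<Rightarrow> bool" where
  "semi_ring_on E H \<longleftrightarrow>
     H \<subseteq> Pow E \<and>
     (\<forall>A\<in>H. \<forall>B\<in>H. A \<inter> B \<in> H) \<and>
     (\<forall>A\<in>H. \<forall>B\<in>H. \<exists>K\<subseteq>H. finite K \<and> disjoint K \<and> B - A = \<Union>K)"

text \<open>Families of sets are summed without repetition and without an enumeration; in \<open>ennreal\<close>
  the unordered sum always converges (\<open>nonneg_summable_on_complete\<close>), so \<open>infsum\<close> is never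
  its default value. The case \<open>K = {}\<close> yields \<open>m {} = 0\<close> when \<open>{} \<in> H\<close>.\<close>

definition sigma_additive_on :: "'a set set \<Rightarrow> ('a set \<Rightarrow> ennreal) \<Rightarrow> bool" where
  "sigma_additive_on H m \<longleftrightarrow>
     (\<forall>K\<subseteq>H. countable K \<and> disjoint K \<and> \<Union>K \<in> H \<longrightarrow> m (\<Union>K) = (\<Sum>\<^sub>\<infinity>G\<in>K. m G))"

definition sigma_finite_on :: "'a set \<Rightarrow> 'a set set \<Rightarrow> ('a set \<Rightarrow> ennreal) \<Rightarrow> bool" where
  "sigma_finite_on E H m \<longleftrightarrow>
     (\<exists>C\<subseteq>H. countable C \<and> (\<forall>G\<in>C. m G < \<infinity>) \<and> E \<subseteq> \<Union>C)"

text \<open>Unlike in the library's \<open>outer_measure\<close>, the covering sets need not be disjoint, and a cover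
  may be finite or empty. If \<open>A\<close> has no countable cover, the value is \<open>Inf {} = \<infinity>\<close>.\<close>

definition cover_outer_measure :: "'a set set \<Rightarrow> ('a set \<Rightarrow> ennreal) \<Rightarrow> 'a set \<Rightarrow> ennreal" where
  "cover_outer_measure H m A =
     Inf {(\<Sum>\<^sub>\<infinity>G\<in>\<G>. m G) |\<G>. \<G> \<subseteq> H \<and> countable \<G> \<and> A \<subseteq> \<Union>\<G>}"

text \<open>Complements are taken relative to the base set \<open>E\<close>, which may be smaller than the type.\<close>

definition caratheodory_sets :: "'a set \<Rightarrow> ('a set \<Rightarrow> ennreal) \<Rightarrow> 'a set set" where
  "caratheodory_sets E \<mu> =
     {A. A \<subseteq> E \<and> (\<forall>B\<subseteq>E. \<mu> B = \<mu> (B \<inter> A) + \<mu> (B \<inter> (E - A)))}"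

end

theory Submission
  imports Defs
begin

text \<open>Adjoining the empty set to \<open>H\<close> gives a semi-ring in the sense of the library, on which \<open>m\<close>
  is countably additive, so \<open>m\<close> extends to a measure \<open>\<nu>\<close> on \<open>\<sigma>(H)\<close>. The outer measure by arbitrary
  countable covers from \<open>H\<close> equals the one by disjoint covers from the generated ring: a sequence of
  ring elements splits into members of \<open>H\<close> without changing the total \<open>\<nu>\<close>-mass, and conversely a
  cover can be made disjoint within the ring. Caratheodory's theorem for rings then applies.\<close>

lemma suminf_ennreal_eq_infsum:
  fixes f :: "nat \<Rightarrow> ennreal"
  shows "(\<Sum>n. f n) = (\<Sum>\<^sub>\<infinity>n\<in>UNIV. f n)"
  by (intro sums_unique[symmetric] has_sum_imp_sums has_sum_infsum nonneg_summable_on_complete) simp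

text \<open>In a disjoint sequence only the empty set can repeat, and there \<open>f\<close>
  vanishes. So passing from indices to the set of values loses nothing.\<close>

lemma suminf_disjoint_family_eq_infsum:
  fixes A :: "nat \<Rightarrow> 'a set" and f :: "'a set \<Rightarrow> ennreal"
  assumes "disjoint_family A" "f {} = 0"
  shows "(\<Sum>n. f (A n)) = (\<Sum>\<^sub>\<infinity>G\<in>range A - {{}}. f G)"
proof -
  let ?I = "{n. A n \<noteq> {}}"
  have "inj_on A ?I"
    using assms(1) by (auto simp: inj_on_def disjoint_family_on_def)
  then have "infsum f (A ` ?I) = infsum (\<lambda>n. f (A n)) ?I"
    by (simp add: infsum_reindex o_def)
  also have "\<dots> = infsum (\<lambda>n. f (A n)) UNIV"
    using assms(2) by (intro infsum_cong_neutral) auto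
  moreover have "A ` ?I = range A - {{}}"
    by auto
  ultimately show ?thesis
    by (simp add: suminf_ennreal_eq_infsum)
qed

text \<open>Each member sits at its own index and all other places are padded with
  \<open>{}\<close>, where \<open>f\<close> vanishes. This treats finite, empty and infinite
  \<open>K\<close> alike.\<close>

lemma countable_family_as_sequence:
  fixes K :: "'a set set" and f :: "'a set \<Rightarrow> ennreal"
  assumes "countable K" "f {} = 0"
  obtains A :: "nat \<Rightarrow> 'a set"
  where "range A \<subseteq> insert {} K" "(\<Union>n. A n) = \<Union>K" "(\<Sum>n. f (A n)) = (\<Sum>\<^sub>\<infinity>G\<in>K. f G)"
    "disjoint K \<Longrightarrow> disjoint_family A"
proof -
  let ?N = "to_nat_on K ` K"
  \<comment> \<open>Outside \<open>?N\<close> the value of \<open>from_nat_into K n\<close> is an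
    arbitrary choice that would repeat a member of \<open>K\<close>, hence the case
    distinction.\<close>
  define A where "A n = (if n \<in> ?N then from_nat_into K n else {})" for n
  have inj: "inj_on (to_nat_on K) K"
    using assms(1) by (rule inj_on_to_nat_on)
  have A_eq: "A (to_nat_on K G) = G" if "G \<in> K" for G
    using that assms(1) by (simp add: A_def)
  have A_cases: "A n = {} \<or> (\<exists>G\<in>K. n = to_nat_on K G \<and> A n = G)" for n
    using A_eq by (auto simp: A_def)
  have "(\<Sum>n. f (A n)) = infsum (\<lambda>n. f (A n)) ?N"
    unfolding suminf_ennreal_eq_infsum
    using assms(2) by (intro infsum_cong_neutral) (auto simp: A_def)
  also have "\<dots> = infsum f K"
    unfolding infsum_reindex[OF inj] using A_eq by (intro infsum_cong) simp
  finally have "(\<Sum>n. f (A n)) = infsum f K" .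
  moreover have "range A \<subseteq> insert {} K"
    using A_cases by blast
  moreover have "(\<Union>n. A n) = \<Union>K"
    using A_cases A_eq by blast
  moreover have "disjoint_family A" if "disjoint K"
    unfolding disjoint_family_on_def
  proof (intro ballI impI)
    fix i j :: nat assume "i \<noteq> j"
    then show "A i \<inter> A j = {}"
      using A_cases[of i] A_cases[of j] disjointD[OF that] by blast
  qed
  ultimately show ?thesis
    by (intro that)
qed

lemma measure_space_infsum_disjoint:
  assumes "measure_space \<Omega> \<A> \<nu>" "K \<subseteq> \<A>" "countable K" "disjoint K"
  shows "(\<Sum>\<^sub>\<infinity>G\<in>K. \<nu> G) = \<nu> (\<Union>K)"
proof -
  interpret sigma_algebra \<Omega> \<A>
    using assms(1) by (simp add: measure_space_def)
  have "\<nu> {} = 0"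
    using assms(1) by (simp add: measure_space_def positive_def)
  then obtain A :: "nat \<Rightarrow> 'a set" where
    A: "range A \<subseteq> insert {} K" "(\<Union>n. A n) = \<Union>K" "(\<Sum>n. \<nu> (A n)) = (\<Sum>\<^sub>\<infinity>G\<in>K. \<nu> G)"
      "disjoint_family A"
    using countable_family_as_sequence[OF assms(3), of \<nu> thesis] assms(4) by blast
  then have "range A \<subseteq> \<A>" "\<Union>K \<in> \<A>"
    using assms(2,3) by auto
  with A assms(1) show ?thesis
    by (auto simp: measure_space_def countably_additive_def)
qed

lemma cover_outer_measure_cong:
  assumes "\<And>G. G \<in> H \<Longrightarrow> f G = g G"
  shows "cover_outer_measure H f A = cover_outer_measure H g A"
proof -
  have "infsum f \<G> = infsum g \<G>" if "\<G> \<subseteq> H" for \<G>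
    using assms that by (intro infsum_cong) auto
  then show ?thesis
    unfolding cover_outer_measure_def by (intro arg_cong[where f = Inf] Collect_cong) metis
qed

text \<open>Allows a measure on the generated sigma-algebra to be restricted to the ring.\<close>

lemma (in semiring_of_sets) generated_ring_subset_sigma_sets:
  "generated_ring \<subseteq> sigma_sets \<Omega> M"
proof
  interpret S: sigma_algebra \<Omega> "sigma_sets \<Omega> M"
    using space_closed by (rule sigma_algebra_sigma_sets)
  fix A assume "A \<in> generated_ring"
  then show "A \<in> sigma_sets \<Omega> M"
    by (elim generated_ringE) auto
qed

lemma (in semiring_of_sets) cover_outer_measure_eq_outer_measure:
  assumes M: "M = insert {} H" and \<nu>: "measure_space \<Omega> (sigma_sets \<Omega> M) \<nu>"
  shows "cover_outer_measure H \<nu> X = outer_measure generated_ring \<nu> X"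
proof (rule antisym)
  interpret R: ring_of_sets \<Omega> generated_ring
    by (rule generating_ring)
  have MR: "M \<subseteq> generated_ring"
    using generated_ringI_Basic by auto
  have pos: "positive generated_ring \<nu>" and ca: "countably_additive generated_ring \<nu>"
    using \<nu> generated_ring_subset_sigma_sets
    by (auto simp: measure_space_def positive_def countably_additive_def)
  then have inc: "increasing generated_ring \<nu>"
    by (metis R.additive_increasing R.countably_additive_additive)
  show "outer_measure generated_ring \<nu> X \<le> cover_outer_measure H \<nu> X"
    unfolding cover_outer_measure_def
  proof (safe intro!: Inf_greatest)
    fix \<G> assume \<G>: "\<G> \<subseteq> H" "countable \<G>" "X \<subseteq> \<Union>\<G>"
    obtain A :: "nat \<Rightarrow> 'a set" where
      A: "range A \<subseteq> insert {} \<G>" "(\<Union>n. A n) = \<Union>\<G>" "(\<Sum>n. \<nu> (A n)) = (\<Sum>\<^sub>\<infinity>G\<in>\<G>. \<nu> G)"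
      using countable_family_as_sequence[of \<G> \<nu>] \<G>(2) pos by (metis positive_def)
    have "range A \<subseteq> generated_ring"
      using A(1) \<G>(1) M MR by blast
    \<comment> \<open>\<open>R.outer_measure_le\<close> makes the cover disjoint inside the ring,
      which by monotonicity does not raise the sum.\<close>
    then show "outer_measure generated_ring \<nu> X \<le> (\<Sum>\<^sub>\<infinity>G\<in>\<G>. \<nu> G)"
      using R.outer_measure_le[OF pos inc] A \<G>(3) by metis
  qed
  show "cover_outer_measure H \<nu> X \<le> outer_measure generated_ring \<nu> X"
    unfolding outer_measure_def
  proof (safe intro!: INF_greatest)
    fix A :: "nat \<Rightarrow> 'a set"
    assume A: "range A \<subseteq> generated_ring" "disjoint_family A" "X \<subseteq> (\<Union>n. A n)"
    have "\<exists>C. finite C \<and> disjoint C \<and> C \<subseteq> M \<and> A n = \<Union>C" for n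
      using A(1) by (meson generated_ringE range_subsetD)
    then obtain C where
      C: "\<And>n. finite (C n)" "\<And>n. disjoint (C n)" "\<And>n. C n \<subseteq> M" "\<And>n. A n = \<Union>(C n)"
      by metis
    \<comment> \<open>The empty set is removed because it need not belong to
      \<open>H\<close>.\<close>
    define \<G> where "\<G> = (\<Union>n. C n) - {{}}"
    have \<G>: "\<G> \<subseteq> H" "countable \<G>"
      using C(1,3) M by (auto simp: \<G>_def countable_finite)
    have union: "\<Union>\<G> = (\<Union>n. A n)"
      by (auto simp: \<G>_def C(4))
    have "disjoint \<G>"
    proof (rule disjointI)
      fix P Q assume PQ: "P \<in> \<G>" "Q \<in> \<G>" "P \<noteq> Q"
      then obtain i j where ij: "P \<in> C i" "Q \<in> C j"
        by (auto simp: \<G>_def)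
      show "P \<inter> Q = {}"
      proof (cases "i = j")
        case True
        then show ?thesis using C(2) ij PQ(3) by (metis disjointD)
      next
        case False
        then have "A i \<inter> A j = {}"
          using A(2) by (auto simp: disjoint_family_on_def)
        then show ?thesis using C(4) ij by blast
      qed
    qed
    \<comment> \<open>Both sums are compared with the mass of the common union, which avoids
      rearranging a double sum. This union may leave the ring, so \<open>\<nu>\<close> has to be a
      measure on the whole sigma-algebra.\<close>
    then have "(\<Sum>\<^sub>\<infinity>G\<in>\<G>. \<nu> G) = \<nu> (\<Union>n. A n)"
      using measure_space_infsum_disjoint[OF \<nu> _ \<G>(2)] \<G>(1) M union
      by (metis sigma_sets_superset_generator subset_insertI subset_trans)
    also have "\<dots> = (\<Sum>n. \<nu> (A n))"
    proof -
      have "range A \<subseteq> sigma_sets \<Omega> M"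
        using A(1) generated_ring_subset_sigma_sets by blast
      moreover from this have "(\<Union>n. A n) \<in> sigma_sets \<Omega> M"
        by (auto intro: sigma_sets.Union)
      ultimately show ?thesis
        using \<nu> A(2) by (auto simp: measure_space_def countably_additive_def)
    qed
    finally show "cover_outer_measure H \<nu> X \<le> (\<Sum>n. \<nu> (A n))"
      unfolding cover_outer_measure_def
      using \<G> union A(3) by (intro Inf_lower) (auto intro!: exI[of _ \<G>])
  qed
qed

lemma semi_ring_on_imp_semiring_of_sets:
  assumes "semi_ring_on E H"
  shows "semiring_of_sets E (insert {} H)"
proof
  show "insert {} H \<subseteq> Pow E"
    using assms by (auto simp: semi_ring_on_def)
  show "a \<inter> b \<in> insert {} H" if "a \<in> insert {} H" "b \<in> insert {} H" for a b
    using assms that by (auto simp: semi_ring_on_def)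
  show "\<exists>C\<subseteq>insert {} H. finite C \<and> disjoint C \<and> a - b = \<Union>C"
    if ab: "a \<in> insert {} H" "b \<in> insert {} H" for a b
  proof (cases "a \<in> H \<and> b \<in> H")
    case True
    then show ?thesis
      using assms unfolding semi_ring_on_def by (meson subset_insertI2)
  next
    \<comment> \<open>One of \<open>a\<close> and \<open>b\<close> is empty, so \<open>a - b\<close>
      is \<open>a\<close> or \<open>{}\<close> and a single piece suffices.\<close>
    case False
    then have "a - b = \<Union>{a - b}" "{a - b} \<subseteq> insert {} H"
      using ab by auto
    then show ?thesis
      by (intro exI[of _ "{a - b}"]) (simp add: disjoint_def)
  qed
qed simp

lemma sigma_additive_on_empty:
  "sigma_additive_on H m \<Longrightarrow> {} \<in> H \<Longrightarrow> m {} = 0"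
  unfolding sigma_additive_on_def by (auto dest!: spec[of _ "{}"] simp: disjoint_def)

text \<open>If \<open>{}\<close> is not in \<open>H\<close>, nothing is known about
  \<open>m {}\<close>; the update supplies the only value compatible with additivity on
  \<open>insert {} H\<close>.\<close>

lemma sigma_additive_on_imp_countably_additive:
  assumes "sigma_additive_on H m"
  shows "countably_additive (insert {} H) (m({} := 0))"
  unfolding countably_additive_def
proof (intro allI impI)
  let ?f = "m({} := 0)"
  fix A :: "nat \<Rightarrow> 'a set"
  assume A: "range A \<subseteq> insert {} H" "disjoint_family A" "(\<Union>n. A n) \<in> insert {} H"
  let ?K = "range A - {{}}"
  have K: "?K \<subseteq> H" "countable ?K" "disjoint ?K" "\<Union>?K = (\<Union>n. A n)"
    using A(1) disjoint_family_on_disjoint_image[OF A(2)]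
    by (auto simp: disjoint_def pairwise_def)
  have "(\<Sum>n. ?f (A n)) = (\<Sum>\<^sub>\<infinity>G\<in>?K. ?f G)"
    using A(2) by (intro suminf_disjoint_family_eq_infsum) simp_all
  also have "\<dots> = (\<Sum>\<^sub>\<infinity>G\<in>?K. m G)"
    by (intro infsum_cong) simp
  also have "\<dots> = ?f (\<Union>n. A n)"
  \<comment> \<open>An empty union may lie outside \<open>H\<close>, where sigma-additivity of
    \<open>m\<close> says nothing; but then no nonempty set is left to sum.\<close>
  proof (cases "(\<Union>n. A n) = {}")
    case True
    then have "?K = {}"
      by auto
    then show ?thesis
      using True by simp
  next
    case False
    then have "\<Union>?K \<in> H"
      using A(3) K(4) by auto
    then have "m (\<Union>?K) = (\<Sum>\<^sub>\<infinity>G\<in>?K. m G)"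
      using assms K(1-3) unfolding sigma_additive_on_def by blast
    then show ?thesis
      using False K(4) by simp
  qed
  finally show "(\<Sum>n. ?f (A n)) = ?f (\<Union>n. A n)" .
qed

lemma lambda_system_Pow_eq_caratheodory_sets:
  "lambda_system E (Pow E) \<mu> = caratheodory_sets E \<mu>"
  unfolding lambda_system_def caratheodory_sets_def
  by (auto simp: Int_commute)

theorem theorem4p7:
  fixes E :: "'a set" and H :: "'a set set" and m :: "'a set \<Rightarrow> ennreal"
  assumes "semi_ring_on E H"
    and "m \<in> H \<rightarrow> {0..<\<infinity>}"
    and "sigma_finite_on E H m"
    and "sigma_additive_on H m"
  shows "sigma_sets E H \<subseteq> caratheodory_sets E (cover_outer_measure H m) \<and>
         (\<forall>A\<in>H. cover_outer_measure H m A = m A)"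
proof -
  let ?M = "insert {} H"
  interpret S: semiring_of_sets E ?M
    using assms(1) by (rule semi_ring_on_imp_semiring_of_sets)
  let ?R = "S.generated_ring"
  interpret R: ring_of_sets E ?R
    by (rule S.generating_ring)
  have "positive ?M (m({} := 0))"
    by (simp add: positive_def)
  then obtain \<nu> where \<nu>: "\<forall>A\<in>?M. \<nu> A = (m({} := 0)) A" "measure_space E (sigma_sets E ?M) \<nu>"
    using S.caratheodory sigma_additive_on_imp_countably_additive[OF assms(4)] by metis
  have \<nu>_eq: "\<nu> A = m A" if "A \<in> H" for A
    using \<nu>(1) that sigma_additive_on_empty[OF assms(4)] by auto
  let ?O = "outer_measure ?R \<nu>"
  \<comment> \<open>Covers only see values on \<open>H\<close>, where \<open>m\<close> and
    \<open>\<nu>\<close> agree.\<close>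
  have outer: "cover_outer_measure H m = ?O"
    using S.cover_outer_measure_eq_outer_measure[OF refl \<nu>(2)] cover_outer_measure_cong[of H \<nu> m]
      \<nu>_eq by (metis ext)
  have HR: "H \<subseteq> ?R"
    using S.generated_ringI_Basic by auto
  have pos: "positive ?R \<nu>" and ca: "countably_additive ?R \<nu>"
    using \<nu>(2) S.generated_ring_subset_sigma_sets
    by (auto simp: measure_space_def positive_def countably_additive_def)
  have add: "additive ?R \<nu>"
    using pos ca by (rule R.countably_additive_additive)
  have inc: "increasing ?R \<nu>"
    using pos add by (rule R.additive_increasing)
  have "measure_space E (lambda_system E (Pow E) ?O) ?O"
    using R.outer_measure_space_outer_measure[OF pos inc]
    by (rule sigma_algebra.caratheodory_lemma[OF sigma_algebra_Pow])
  then have "sigma_algebra E (lambda_system E (Pow E) ?O)"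
    by (simp add: measure_space_def)
  \<comment> \<open>Only generators need checking. Cutting each set of a cover along a ring element
    stays in the ring, and additivity adds up the two parts.\<close>
  moreover have "H \<subseteq> lambda_system E (Pow E) ?O"
    using HR R.algebra_subset_lambda_system[OF pos inc add] by simp
  ultimately have "sigma_sets E H \<subseteq> caratheodory_sets E ?O"
    by (metis lambda_system_Pow_eq_caratheodory_sets sigma_algebra.sigma_sets_subset)
  \<comment> \<open>The set covers itself, which bounds \<open>?O A\<close> above. For the lower
    bound, a disjoint cover cuts \<open>A\<close> into ring elements whose masses sum to
    \<open>\<nu> A\<close> by countable additivity.\<close>
  moreover have "?O A = m A" if "A \<in> H" for A
    using R.outer_measure_agrees[OF pos ca] HR \<nu>_eq that by auto
  ultimately show ?thesis
    by (simp add: outer)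
qed

end
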